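(* For every integer $q\geq1$, the big Coppersmith–Winograd tensor $$\mathrm{CW}_q:=e_0\otimes e_0\otimes e_{q+1}+e_0\otimes e_{q+1}\otimes e_0+e_{q+1}\otimes e_0\otimes e_0+\sum_{i=1}^q\bigl(e_0\otimes e_i\otimes e_i+e_i\otimes e_0\otimes e_i+e_i\otimes e_i\otimes e_0\bigr)$$ in $\mathbb{F}^{q+2}\otimes\mathbb{F}^{q+2}\otimes\mathbb{F}^{q+2}$ (basis $e_0,\dots,e_{q+1}$) satisfies $$2\,\mathrm{irr}(\mathrm{CW}_q)\geq\begin{cases}\dfrac{2\log_2 3}{f_1\bigl(\tfrac1{18}(\sqrt{33}-3)\bigr)} & q=1,\\[2ex] \dfrac{2\log_2 4}{f_2(\tfrac19)} & q=2,\\[2ex] \dfrac{2\log_2(q+2)}{f_q\Bigl(\frac{3q-\sqrt{32+q^2}}{6(q^2-4)}\Bigr)} & q\geq3,\end{cases}$$ where $$f_q(x):=-\Bigl(\tfrac23-qx\Bigr)\log_2\Bigl(\tfrac23-qx\Bigr)-2qx\log_2(2x)-\Bigl(\tfrac13-qx\Bigr)\log_2\Bigl(\tfrac13-qx\Bigr).$$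
   Context: Tensors are 3-tensors over a fixed field $\mathbb{F}$. Write $t\geq s$ if there are linear maps $A_i$ with $(A_1\otimes A_2\otimes A_3)t=s$; $\langle n\rangle:=\sum_{i=1}^n e_i\otimes e_i\otimes e_i$; relative exponent $\omega(t,s):=\lim_{n\to\infty}\frac1n\min\{m\in\mathbb{N}: t^{\otimes m}\geq s^{\otimes n}\}$ (tensor powers regarded as 3-tensors by grouping factors); irreversibility $\mathrm{irr}(t):=\omega(\langle2\rangle,t)\,\omega(t,\langle2\rangle)$, equivalently $\log_2$ of the asymptotic rank $\lim_n \mathrm{R}(t^{\otimes n})^{1/n}$ divided by $\log_2$ of the asymptotic subrank $\lim_n\mathrm{Q}(t^{\otimes n})^{1/n}$, where $\mathrm{R}(t)=\min\{n:t\leq\langle n\rangle\}$ and $\mathrm{Q}(t)=\max\{n:\langle n\rangle\leq t\}$. *)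

theory Defs
  imports Complex_Main "HOL-Library.Extended_Real"
begin

text \<open>
  A 3-tensor in coordinates: an element of \<open>F\<^sup>I \<otimes> F\<^sup>J \<otimes> F\<^sup>K\<close> for finite index sets
  \<open>I\<close>, \<open>J\<close>, \<open>K\<close>, given by its coefficients with respect to the standard bases. Only the
  coefficients at indices from \<open>I \<times> J \<times> K\<close> are meaningful.
\<close>

datatype ('i, 'f) tensor3 =
  Tensor3 (idx1: "'i set") (idx2: "'i set") (idx3: "'i set") (coeff: "'i \<Rightarrow> 'i \<Rightarrow> 'i \<Rightarrow> 'f")

text \<open>
  \<open>t \<ge> s\<close>: the linear maps \<open>A\<close>, \<open>B\<close>, \<open>C\<close> are given by their matrices, and equality of tensors
  is equality of the coefficients on the index sets of \<open>s\<close>.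
\<close>

definition restricts_to :: "('i, 'f::field) tensor3 \<Rightarrow> ('j, 'f) tensor3 \<Rightarrow> bool"
    (infix "\<succeq>\<^sub>T" 50) where
  "t \<succeq>\<^sub>T s \<longleftrightarrow>
    (\<exists>(A :: 'j \<Rightarrow> 'i \<Rightarrow> 'f) (B :: 'j \<Rightarrow> 'i \<Rightarrow> 'f) (C :: 'j \<Rightarrow> 'i \<Rightarrow> 'f).
      \<forall>i'\<in>idx1 s. \<forall>j'\<in>idx2 s. \<forall>k'\<in>idx3 s.
        (\<Sum>i\<in>idx1 t. \<Sum>j\<in>idx2 t. \<Sum>k\<in>idx3 t. A i' i * B j' j * C k' k * coeff t i j k)
          = coeff s i' j' k')"

text \<open>
  The tensor power, with factors grouped into a 3-tensor: the standard basis of the \<open>n\<close>-th tensor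
  power of \<open>F\<^sup>I\<close> is indexed by the lists of length \<open>n\<close> over \<open>I\<close>.
\<close>

definition tensor_power :: "('i, 'f::field) tensor3 \<Rightarrow> nat \<Rightarrow> ('i list, 'f) tensor3" where
  "tensor_power t n = Tensor3
     {xs. set xs \<subseteq> idx1 t \<and> length xs = n}
     {ys. set ys \<subseteq> idx2 t \<and> length ys = n}
     {zs. set zs \<subseteq> idx3 t \<and> length zs = n}
     (\<lambda>xs ys zs. \<Prod>l<n. coeff t (xs ! l) (ys ! l) (zs ! l))"

text \<open>Coefficients of \<open>e\<^sub>a \<otimes> e\<^sub>b \<otimes> e\<^sub>c\<close>.\<close>

definition basis3 :: "'i \<Rightarrow> 'i \<Rightarrow> 'i \<Rightarrow> 'i \<Rightarrow> 'i \<Rightarrow> 'i \<Rightarrow> 'f::field" where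
  "basis3 a b c i j k = (if i = a \<and> j = b \<and> k = c then 1 else 0)"

definition unit_tensor :: "nat \<Rightarrow> (nat, 'f::field) tensor3" where
  "unit_tensor n = Tensor3 {1..n} {1..n} {1..n} (\<lambda>i j k. \<Sum>l=1..n. basis3 l l l i j k)"

text \<open>
  The infimum in \<^typ>\<open>enat\<close> is the minimum of the set if it is nonempty, and \<open>\<infinity>\<close> otherwise.
\<close>

definition min_power :: "('i, 'f::field) tensor3 \<Rightarrow> ('j, 'f) tensor3 \<Rightarrow> nat \<Rightarrow> enat" where
  "min_power t s n = Inf (enat ` {m. tensor_power t m \<succeq>\<^sub>T tensor_power s n})"

definition rel_exponent :: "('i, 'f::field) tensor3 \<Rightarrow> ('j, 'f) tensor3 \<Rightarrow> ereal" where
  "rel_exponent t s = lim (\<lambda>n. ereal (1 / real n) * ereal_of_enat (min_power t s n))"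

definition irr :: "('i, 'f::field) tensor3 \<Rightarrow> ereal" where
  "irr t = rel_exponent (unit_tensor 2 :: (nat, 'f) tensor3) t
         * rel_exponent t (unit_tensor 2 :: (nat, 'f) tensor3)"

definition CW :: "nat \<Rightarrow> (nat, 'f::field) tensor3" where
  "CW q = Tensor3 {0..q+1} {0..q+1} {0..q+1}
     (\<lambda>i j k. basis3 0 0 (q+1) i j k + basis3 0 (q+1) 0 i j k + basis3 (q+1) 0 0 i j k
        + (\<Sum>l=1..q. basis3 0 l l i j k + basis3 l 0 l i j k + basis3 l l 0 i j k))"

definition cw_f :: "nat \<Rightarrow> real \<Rightarrow> real" where
  "cw_f q x = - (2/3 - real q * x) * log 2 (2/3 - real q * x)
              - 2 * real q * x * log 2 (2 * x)
              - (1/3 - real q * x) * log 2 (1/3 - real q * x)"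

end

theory Submission imports Defs begin

text \<open>
  A restriction of \<open>\<langle>2\<rangle>\<^sup>m\<close> to \<open>CW\<^sub>q\<^sup>n\<close> forces \<open>2\<^sup>m \<ge> (q + 2)\<^sup>n\<close>, because the slice of \<open>CW\<^sub>q\<close> at
  \<open>j = 0\<close> is a permutation matrix. For the subrank, put weights \<open>p\<^sub>0 = 2/3 - q x\<close>, \<open>p\<^sub>i = 2 x\<close>,
  \<open>p\<^bsub>q+1\<^esub> = 1/3 - q x\<close> on the basis vectors. They sum to 1, and the \<open>x\<close> of the theorem solves
  \<open>p\<^sub>0 p\<^bsub>q+1\<^esub> = p\<^sub>i\<^sup>2\<close>, so that the product of the three weights equals \<open>c\<^sup>3\<close> with
  \<open>c = 2 powr (- f\<^sub>q(x))\<close> on the whole support of \<open>CW\<^sub>q\<close>. In the support of \<open>CW\<^sub>q\<^sup>m\<close>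
  one of the three indices therefore has weight at least \<open>c\<^sup>m\<close>, and at most \<open>c\<^bsup>-m\<^esup>\<close> indices do.
  So \<open>CW\<^sub>q\<^sup>m\<close> has slice rank at most \<open>3 c\<^bsup>-m\<^esup>\<close>, while \<open>\<langle>2\<rangle>\<^sup>n\<close> has slice rank \<open>2\<^sup>n\<close> by Tao's lemma.
\<close>

section \<open>Linear algebra\<close>

text \<open>Gaussian elimination by induction on the equations: if equation \<open>e\<close> has a
  nonzero coefficient at \<open>s0\<close>, it is solved for the unknown at \<open>s0\<close>, and
  substitution leaves one equation and one unknown fewer.\<close>

lemma homogeneous_system_nonzero_solution:
  fixes c :: "'e \<Rightarrow> 's \<Rightarrow> 'f::field"
  assumes "finite E" "finite S" "card E < card S"
  shows "\<exists>u. (\<exists>s\<in>S. u s \<noteq> 0) \<and> (\<forall>e\<in>E. (\<Sum>s\<in>S. c e s * u s) = 0)"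
  using assms
proof (induction E arbitrary: S c rule: finite_induct)
  case empty
  then obtain s where "s \<in> S" by fastforce
  then show ?case by (intro exI[of _ "\<lambda>_. 1"]) auto
next
  case (insert e E)
  show ?case
  proof (cases "\<forall>s\<in>S. c e s = 0")
    case True
    have "card E < card S" using insert by simp
    from insert.IH[OF insert.prems(1) this, of c] show ?thesis using True by auto
  next
    case False
    then obtain s0 where s0: "s0 \<in> S" "c e s0 \<noteq> 0" by auto
    define S' where "S' = S - {s0}"
    have S': "finite S'" "s0 \<notin> S'" "S = insert s0 S'" using s0 insert.prems by (auto simp: S'_def)
    have "card E < card S'" using insert S' by simp
    \<comment> \<open>Row \<open>e\<close>, scaled to agree with row \<open>f\<close> at
      \<open>s0\<close>, is subtracted from row \<open>f\<close>.\<close>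
    from insert.IH[OF S'(1) this, of "\<lambda>f s. c f s - c f s0 * c e s / c e s0"]
    obtain u where u: "\<exists>s\<in>S'. u s \<noteq> 0"
      "\<And>f. f \<in> E \<Longrightarrow> (\<Sum>s\<in>S'. (c f s - c f s0 * c e s / c e s0) * u s) = 0" by blast
    \<comment> \<open>\<open>- r\<close> is the value at \<open>s0\<close> that equation
      \<open>e\<close> forces once \<open>u\<close> is fixed on \<open>S'\<close>.\<close>
    define r where "r = (\<Sum>s\<in>S'. c e s * u s) / c e s0"
    define v where "v = u(s0 := - r)"
    have v: "(\<Sum>s\<in>S. c f s * v s) = (\<Sum>s\<in>S'. c f s * u s) - c f s0 * r" for f
    proof -
      have "(\<Sum>s\<in>S'. c f s * v s) = (\<Sum>s\<in>S'. c f s * u s)"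
        using S' by (intro sum.cong) (auto simp: v_def)
      then show ?thesis using S' by (simp add: v_def)
    qed
    have "(\<Sum>s\<in>S. c f s * v s) = 0" if "f \<in> E" for f
    proof -
      have "(\<Sum>s\<in>S'. c f s * u s) - c f s0 * r
          = (\<Sum>s\<in>S'. (c f s - c f s0 * c e s / c e s0) * u s)"
        by (simp add: r_def sum_subtractf algebra_simps sum_distrib_left sum_divide_distrib)
      then show ?thesis using u(2)[OF that] v by simp
    qed
    moreover have "(\<Sum>s\<in>S. c e s * v s) = 0" using v[of e] s0 by (simp add: r_def)
    moreover have "\<exists>s\<in>S. v s \<noteq> 0" using u(1) S' by (auto simp: v_def)
    ultimately show ?thesis by (intro exI[of _ v]) auto
  qed
qed

text \<open>If \<open>P\<close> were smaller than \<open>I\<close>, the transpose of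
  \<open>A\<close> would annihilate some nonzero \<open>u\<close>; but pairing \<open>u\<close> with
  the product matrix, an identity, returns \<open>u\<close>.\<close>

lemma identity_factorization_card_le:
  fixes A :: "'i \<Rightarrow> 'p \<Rightarrow> 'f::field"
  assumes "finite I" "finite P"
    and eq: "\<And>i j. i \<in> I \<Longrightarrow> j \<in> I \<Longrightarrow> (\<Sum>p\<in>P. A i p * B p j) = (if i = j then 1 else 0)"
  shows "card I \<le> card P"
proof (rule ccontr)
  assume "\<not> ?thesis"
  then have "card P < card I" by simp
  from homogeneous_system_nonzero_solution[OF assms(2,1) this, of "\<lambda>p i. A i p"]
  obtain u j where u: "j \<in> I" "u j \<noteq> 0" "\<And>p. p \<in> P \<Longrightarrow> (\<Sum>i\<in>I. A i p * u i) = 0" by blast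
  have "u j = (\<Sum>i\<in>I. u i * (if i = j then 1 else 0))"
    using u(1) assms(1) by (simp add: if_distrib[of "\<lambda>x. _ * x"] cong: if_cong)
  also have "\<dots> = (\<Sum>i\<in>I. u i * (\<Sum>p\<in>P. A i p * B p j))" using eq u(1) by simp
  also have "\<dots> = (\<Sum>p\<in>P. (\<Sum>i\<in>I. A i p * u i) * B p j)"
    by (simp add: sum_distrib_left sum_distrib_right sum.swap[of _ P I] mult_ac)
  also have "\<dots> = 0" using u(3) by simp
  finally show False using u(2) by simp
qed

text \<open>Take a solution of maximal support. If the support were too small, a nonzero solution
  vanishing on it would exist, and adding that one would enlarge the support. No generic choice is
  involved, so finite fields are covered.\<close>

lemma large_support_solution:
  fixes c :: "'e \<Rightarrow> 's \<Rightarrow> 'f::field"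
  assumes fin: "finite E" "finite S"
  shows "\<exists>h. (\<forall>e\<in>E. (\<Sum>s\<in>S. c e s * h s) = 0) \<and> card S \<le> card {s\<in>S. h s \<noteq> 0} + card E"
proof -
  define sol where "sol h \<longleftrightarrow> (\<forall>e\<in>E. (\<Sum>s\<in>S. c e s * h s) = 0)" for h
  have "sol (\<lambda>_. 0)" by (simp add: sol_def)
  moreover have "card {s\<in>S. h s \<noteq> 0} \<le> card S" for h :: "'s \<Rightarrow> 'f"
    using fin by (intro card_mono) auto
  ultimately have "\<exists>h. sol h \<and> (\<forall>g. sol g \<longrightarrow> card {s\<in>S. g s \<noteq> 0} \<le> card {s\<in>S. h s \<noteq> 0})"
    by (intro ex_has_greatest_nat[where b = "Suc (card S)"]) (simp_all add: less_Suc_eq_le)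
  then obtain h where h: "sol h"
    and max: "\<And>g. sol g \<Longrightarrow> card {s\<in>S. g s \<noteq> 0} \<le> card {s\<in>S. h s \<noteq> 0}"
    by blast
  define T where "T = {s\<in>S. h s \<noteq> 0}"
  have T: "T \<subseteq> S" "finite T" using fin by (auto simp: T_def)
  have "card S \<le> card T + card E"
  proof (rule ccontr)
    assume "\<not> ?thesis"
    then have "card (E <+> T) < card S" using fin T by (simp add: card_Plus)
    \<comment> \<open>The right summand of \<open>E <+> T\<close> contributes the equations
      \<open>u t = 0\<close> for \<open>t\<close> in \<open>T\<close>.\<close>
    from homogeneous_system_nonzero_solution[OF finite_Plus[OF fin(1) T(2)] fin(2) this,
        of "case_sum c (\<lambda>t s. if s = t then 1 else 0)"]
    obtain u s0 where u: "s0 \<in> S" "u s0 \<noteq> 0"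
      "\<And>e. e \<in> E <+> T \<Longrightarrow>
        (\<Sum>s\<in>S. case_sum c (\<lambda>t s. if s = t then 1 else 0) e s * u s) = 0"
      by blast
    have uT: "u t = 0" if "t \<in> T" for t
    proof -
      have "(\<Sum>s\<in>S. (if s = t then 1 else 0) * u s) = u t"
        using that T fin by (simp add: if_distrib[of "\<lambda>x. x * _"] subset_iff cong: if_cong)
      then show ?thesis using u(3)[of "Inr t"] that by auto
    qed
    have "(\<Sum>s\<in>S. c e s * (h s + u s)) = 0" if "e \<in> E" for e
      using u(3)[of "Inl e"] h that by (auto simp: sol_def distrib_left sum.distrib)
    then have "sol (\<lambda>s. h s + u s)" by (simp add: sol_def)
    from max[OF this] have le: "card {s\<in>S. h s + u s \<noteq> 0} \<le> card T" by (simp add: T_def)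
    have "s0 \<notin> T" using u(2) uT by auto
    then have "insert s0 T \<subseteq> {s\<in>S. h s + u s \<noteq> 0}"
      using u uT by (auto simp: T_def)
    then have "card (insert s0 T) \<le> card {s\<in>S. h s + u s \<noteq> 0}"
      using fin by (intro card_mono) auto
    then show False using le \<open>s0 \<notin> T\<close> T by simp
  qed
  then show ?thesis using h by (auto simp: sol_def T_def)
qed

text \<open>Tao's bound: a diagonal tensor of size \<open>card S\<close> has slice rank \<open>card S\<close>.\<close>

lemma diagonal_slice_rank:
  fixes t :: "'i \<Rightarrow> 'j \<Rightarrow> 'k \<Rightarrow> 'f::field"
  assumes fin: "finite S" "finite X" "finite Y" "finite Z"
    and supp: "\<And>i j k. i \<in> I \<Longrightarrow> j \<in> J \<Longrightarrow> k \<in> K \<Longrightarrow> t i j k \<noteq> 0 \<Longrightarrow> i \<in> X \<or> j \<in> Y \<or> k \<in> Z"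
    and eq: "\<And>i' j' k'. i' \<in> S \<Longrightarrow> j' \<in> S \<Longrightarrow> k' \<in> S \<Longrightarrow>
      (\<Sum>i\<in>I. \<Sum>j\<in>J. \<Sum>k\<in>K. A i' i * B j' j * C k' k * t i j k)
        = (if i' = j' \<and> j' = k' then 1 else 0)"
  shows "card S \<le> card X + card Y + card Z"
proof -
  \<comment> \<open>Contracting the third leg with \<open>h\<close> removes all indices in
    \<open>Z\<close>, while at least \<open>card S - card Z\<close> diagonal entries stay nonzero.
    What remains is a rank bound for a matrix.\<close>
  obtain h where h: "\<And>z. z \<in> Z \<Longrightarrow> (\<Sum>k'\<in>S. C k' z * h k') = 0"
    and card: "card S \<le> card {s\<in>S. h s \<noteq> 0} + card Z"
    using large_support_solution[OF fin(4,1), of "\<lambda>z k'. C k' z"] by blast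
  define T where "T = {s\<in>S. h s \<noteq> 0}"
  have T: "T \<subseteq> S" "finite T" using fin by (auto simp: T_def)
  define g where "g k = (\<Sum>k'\<in>S. C k' k * h k')" for k
  have "card T \<le> card X + card Y"
  proof (rule ccontr)
    assume "\<not> ?thesis"
    then have "card (X <+> Y) < card T" using fin by (simp add: card_Plus)
    \<comment> \<open>The equations from \<open>X\<close> make the vector \<open>w\<close> below
      vanish on \<open>X\<close>; those from \<open>Y\<close> make the contraction of
      \<open>t\<close> with \<open>w\<close> and \<open>g\<close> vanish at every index in
      \<open>Y\<close>.\<close>
    from homogeneous_system_nonzero_solution[OF finite_Plus[OF fin(2,3)] T(2) this,
        of "case_sum (\<lambda>x i'. A i' x) (\<lambda>y i'. \<Sum>i\<in>I. A i' i * (\<Sum>k\<in>K. g k * t i y k))"]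
    obtain u j' where u: "j' \<in> T" "u j' \<noteq> 0"
      and u_eq: "\<And>e. e \<in> X <+> Y \<Longrightarrow> (\<Sum>i'\<in>T. case_sum (\<lambda>x i'. A i' x)
        (\<lambda>y i'. \<Sum>i\<in>I. A i' i * (\<Sum>k\<in>K. g k * t i y k)) e i' * u i') = 0"
      by blast
    define w where "w i = (\<Sum>i'\<in>T. A i' i * u i')" for i
    have wX: "w x = 0" if "x \<in> X" for x
      using u_eq[of "Inl x"] that by (auto simp: w_def)
    have wY: "(\<Sum>i\<in>I. w i * (\<Sum>k\<in>K. g k * t i y k)) = 0" if "y \<in> Y" for y
    proof -
      have "(\<Sum>i\<in>I. w i * (\<Sum>k\<in>K. g k * t i y k))
          = (\<Sum>i\<in>I. \<Sum>i'\<in>T. A i' i * (\<Sum>k\<in>K. g k * t i y k) * u i')"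
        by (simp add: w_def sum_distrib_right mult_ac)
      also have "\<dots> = (\<Sum>i'\<in>T. (\<Sum>i\<in>I. A i' i * (\<Sum>k\<in>K. g k * t i y k)) * u i')"
        by (subst sum.swap) (simp add: sum_distrib_right)
      finally show ?thesis using u_eq[of "Inr y"] that by auto
    qed
    have j': "j' \<in> S" "h j' \<noteq> 0" using u(1) by (auto simp: T_def)
    \<comment> \<open>The diagonal tensor is contracted with \<open>u\<close> and \<open>h\<close>
      and read off at \<open>j'\<close>, which gives a nonzero value; computed through
      \<open>t\<close>, the same value is zero.\<close>
    have "u j' * h j' = (\<Sum>i'\<in>T. \<Sum>k'\<in>S. u i' * h k' * (if i' = j' \<and> j' = k' then 1 else 0))"
    proof -
      have "(\<Sum>k'\<in>S. u i' * h k' * (if i' = j' \<and> j' = k' then 1 else 0))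
          = (if i' = j' then u i' * h j' else 0)" for i'
        using j' fin by (simp add: if_distrib[of "\<lambda>x. _ * x"] cong: if_cong)
      then show ?thesis using u(1) T by simp
    qed
    also have "\<dots> = (\<Sum>i'\<in>T. \<Sum>k'\<in>S. u i' * h k' *
        (\<Sum>i\<in>I. \<Sum>j\<in>J. \<Sum>k\<in>K. A i' i * B j' j * C k' k * t i j k))"
      using eq j' T by (intro sum.cong refl) (auto simp: subset_iff)
    also have "\<dots> = (\<Sum>i'\<in>T. \<Sum>i\<in>I. \<Sum>j\<in>J. \<Sum>k\<in>K. \<Sum>k'\<in>S.
        u i' * h k' * (A i' i * B j' j * C k' k * t i j k))"
      unfolding sum_distrib_left
      by (simp only: sum.swap[of _ _ S])
    also have "\<dots> = (\<Sum>i\<in>I. \<Sum>j\<in>J. \<Sum>k\<in>K. \<Sum>i'\<in>T. \<Sum>k'\<in>S.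
        u i' * h k' * (A i' i * B j' j * C k' k * t i j k))"
      by (simp only: sum.swap[of _ _ T])
    also have "\<dots> = (\<Sum>i\<in>I. \<Sum>j\<in>J. \<Sum>k\<in>K. B j' j * (w i * (g k * t i j k)))"
      unfolding w_def g_def
      by (simp add: sum_distrib_left sum_distrib_right sum.swap[of _ T S] mult_ac)
    also have "\<dots> = (\<Sum>j\<in>J. B j' j * (\<Sum>i\<in>I. w i * (\<Sum>k\<in>K. g k * t i j k)))"
      by (subst sum.swap) (simp add: sum_distrib_left)
    also have "\<dots> = 0"
    proof (intro sum.neutral ballI)
      fix j assume j: "j \<in> J"
      have "(\<Sum>i\<in>I. w i * (\<Sum>k\<in>K. g k * t i j k)) = 0"
      proof (cases "j \<in> Y")
        case False
        \<comment> \<open>With \<open>j\<close> outside \<open>Y\<close>, a nonzero coefficient has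
          its first index in \<open>X\<close>, where \<open>w\<close> vanishes, or its third in
          \<open>Z\<close>, where \<open>g\<close> vanishes.\<close>
        have "w i * (g k * t i j k) = 0" if "i \<in> I" "k \<in> K" for i k
          using supp[OF that(1) j that(2)] False wX[of i] h[of k] by (auto simp: g_def)
        then show ?thesis unfolding sum_distrib_left by (intro sum.neutral ballI) blast
      qed (rule wY)
      then show "B j' j * (\<Sum>i\<in>I. w i * (\<Sum>k\<in>K. g k * t i j k)) = 0" by simp
    qed
    finally show False using u(2) j'(2) by simp
  qed
  then show ?thesis using card by (simp add: T_def)
qed

section \<open>Tensor powers\<close>

lemma sum_lists_Suc:
  assumes "finite I"
  shows "(\<Sum>xs | set xs \<subseteq> I \<and> length xs = Suc n. f xs)
       = (\<Sum>x\<in>I. \<Sum>xs | set xs \<subseteq> I \<and> length xs = n. f (x # xs))"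
proof -
  have "(\<Sum>x\<in>I. \<Sum>xs | set xs \<subseteq> I \<and> length xs = n. f (x # xs))
      = (\<Sum>(x, xs) \<in> I \<times> {xs. set xs \<subseteq> I \<and> length xs = n}. f (x # xs))"
    using assms by (subst sum.cartesian_product) auto
  also have "\<dots> = (\<Sum>xs | set xs \<subseteq> I \<and> length xs = Suc n. f xs)"
    by (rule sum.reindex_bij_witness[of _ "\<lambda>xs. (hd xs, tl xs)" "\<lambda>(x, xs). x # xs"])
      (auto simp: length_Suc_conv)
  finally show ?thesis by simp
qed

lemma sum_lists_append:
  assumes "finite I"
  shows "(\<Sum>xs | set xs \<subseteq> I \<and> length xs = m + n. f xs)
       = (\<Sum>xs | set xs \<subseteq> I \<and> length xs = m. \<Sum>ys | set ys \<subseteq> I \<and> length ys = n. f (xs @ ys))"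
proof (induction m arbitrary: f)
  case 0
  have "{xs. set xs \<subseteq> I \<and> length xs = 0} = {[]}" by auto
  then show ?case by simp
next
  case (Suc m)
  then show ?case using assms by (simp add: sum_lists_Suc)
qed

lemma prod_lessThan_add:
  "(\<Prod>l<m + n. f l) = (\<Prod>l<m. f l) * (\<Prod>l<n. f (m + l))" for f :: "nat \<Rightarrow> 'a::comm_monoid_mult"
  by (induction n) (simp_all add: mult.assoc)

lemma sum_lists_prod:
  fixes p :: "'i \<Rightarrow> 'a::comm_semiring_1"
  assumes "finite I"
  shows "(\<Sum>xs | set xs \<subseteq> I \<and> length xs = n. \<Prod>l<n. p (xs ! l)) = (\<Sum>i\<in>I. p i) ^ n"
proof (induction n)
  case 0
  have "{xs. set xs \<subseteq> I \<and> length xs = 0} = {[]}" by auto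
  then show ?case by simp
next
  case (Suc n)
  then show ?case
    using assms by (simp add: sum_lists_Suc prod.lessThan_Suc_shift sum_distrib_left[symmetric]
        sum_distrib_right[symmetric] del: prod.lessThan_Suc)
qed

lemma tensor_power_sel [simp]:
  "idx1 (tensor_power t n) = {xs. set xs \<subseteq> idx1 t \<and> length xs = n}"
  "idx2 (tensor_power t n) = {xs. set xs \<subseteq> idx2 t \<and> length xs = n}"
  "idx3 (tensor_power t n) = {xs. set xs \<subseteq> idx3 t \<and> length xs = n}"
  "coeff (tensor_power t n) xs ys zs = (\<Prod>l<n. coeff t (xs ! l) (ys ! l) (zs ! l))"
  by (simp_all add: tensor_power_def)

lemma coeff_tensor_power_append:
  assumes "length xs = m" "length ys = m" "length zs = m"
  shows "coeff (tensor_power t (m + n)) (xs @ xs') (ys @ ys') (zs @ zs')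
       = coeff (tensor_power t m) xs ys zs * coeff (tensor_power t n) xs' ys' zs'"
  using assms by (simp add: prod_lessThan_add nth_append)

text \<open>The Kronecker products of the two triples of matrices do it, with row lists cut after
  \<open>n1\<close> entries and column lists after \<open>m1\<close>. This makes
  \<open>min_power\<close> subadditive.\<close>

lemma restricts_to_tensor_power_add:
  fixes t :: "('i, 'f::field) tensor3" and s :: "('j, 'f) tensor3"
  assumes fin: "finite (idx1 t)" "finite (idx2 t)" "finite (idx3 t)"
    and "tensor_power t m1 \<succeq>\<^sub>T tensor_power s n1" "tensor_power t m2 \<succeq>\<^sub>T tensor_power s n2"
  shows "tensor_power t (m1 + m2) \<succeq>\<^sub>T tensor_power s (n1 + n2)"
proof -
  let ?I = "\<lambda>m. {xs. set xs \<subseteq> idx1 t \<and> length xs = m}"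
  let ?J = "\<lambda>m. {xs. set xs \<subseteq> idx2 t \<and> length xs = m}"
  let ?K = "\<lambda>m. {xs. set xs \<subseteq> idx3 t \<and> length xs = m}"
  let ?c = "\<lambda>m. coeff (tensor_power t m)"
  obtain A1 B1 C1 where 1: "\<And>i' j' k'. i' \<in> idx1 (tensor_power s n1) \<Longrightarrow>
      j' \<in> idx2 (tensor_power s n1) \<Longrightarrow> k' \<in> idx3 (tensor_power s n1) \<Longrightarrow>
      (\<Sum>i\<in>?I m1. \<Sum>j\<in>?J m1. \<Sum>k\<in>?K m1. A1 i' i * B1 j' j * C1 k' k * ?c m1 i j k)
        = coeff (tensor_power s n1) i' j' k'"
    using assms(4) unfolding restricts_to_def tensor_power_sel(1-3) by blast
  obtain A2 B2 C2 where 2: "\<And>i' j' k'. i' \<in> idx1 (tensor_power s n2) \<Longrightarrow>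
      j' \<in> idx2 (tensor_power s n2) \<Longrightarrow> k' \<in> idx3 (tensor_power s n2) \<Longrightarrow>
      (\<Sum>i\<in>?I m2. \<Sum>j\<in>?J m2. \<Sum>k\<in>?K m2. A2 i' i * B2 j' j * C2 k' k * ?c m2 i j k)
        = coeff (tensor_power s n2) i' j' k'"
    using assms(5) unfolding restricts_to_def tensor_power_sel(1-3) by blast
  define M where "M U V i' i = U (take n1 i') (take m1 i) * V (drop n1 i') (drop m1 i)"
    for U V :: "'j list \<Rightarrow> 'i list \<Rightarrow> 'f" and i' i
  have M: "M U V i' (xs @ ys) = U (take n1 i') xs * V (drop n1 i') ys"
    if "length xs = m1" for U V i' xs ys
    using that by (simp add: M_def)
  have "(\<Sum>i\<in>?I (m1 + m2). \<Sum>j\<in>?J (m1 + m2). \<Sum>k\<in>?K (m1 + m2).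
        M A1 A2 i' i * M B1 B2 j' j * M C1 C2 k' k * ?c (m1 + m2) i j k)
      = coeff (tensor_power s (n1 + n2)) i' j' k'"
    if i': "i' \<in> idx1 (tensor_power s (n1 + n2))" and j': "j' \<in> idx2 (tensor_power s (n1 + n2))"
      and k': "k' \<in> idx3 (tensor_power s (n1 + n2))" for i' j' k'
  proof -
    let ?i = "take n1 i'" and ?j = "take n1 j'" and ?k = "take n1 k'"
    let ?i2 = "drop n1 i'" and ?j2 = "drop n1 j'" and ?k2 = "drop n1 k'"
    have "(\<Sum>i\<in>?I (m1 + m2). \<Sum>j\<in>?J (m1 + m2). \<Sum>k\<in>?K (m1 + m2).
        M A1 A2 i' i * M B1 B2 j' j * M C1 C2 k' k * ?c (m1 + m2) i j k)
      = (\<Sum>i\<in>?I m1. \<Sum>i2\<in>?I m2. \<Sum>j\<in>?J m1. \<Sum>j2\<in>?J m2. \<Sum>k\<in>?K m1. \<Sum>k2\<in>?K m2.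
        (A1 ?i i * B1 ?j j * C1 ?k k * ?c m1 i j k)
        * (A2 ?i2 i2 * B2 ?j2 j2 * C2 ?k2 k2 * ?c m2 i2 j2 k2))"
      unfolding sum_lists_append[OF fin(1)] sum_lists_append[OF fin(2)] sum_lists_append[OF fin(3)]
      by (intro sum.cong refl)
        (simp only: mem_Collect_eq M coeff_tensor_power_append mult_ac)
    also have "\<dots> = (\<Sum>i\<in>?I m1. \<Sum>j\<in>?J m1. \<Sum>k\<in>?K m1. A1 ?i i * B1 ?j j * C1 ?k k * ?c m1 i j k)
        * (\<Sum>i\<in>?I m2. \<Sum>j\<in>?J m2. \<Sum>k\<in>?K m2. A2 ?i2 i * B2 ?j2 j * C2 ?k2 k * ?c m2 i j k)"
      by (simp only: sum_product)
    also have "\<dots> = coeff (tensor_power s n1) ?i ?j ?k * coeff (tensor_power s n2) ?i2 ?j2 ?k2"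
      using i' j' k'
      by (intro arg_cong2[where f = "(*)"] 1 2)
        (auto simp del: tensor_power_sel(4) dest!: in_set_takeD in_set_dropD)
    also have "\<dots> = coeff (tensor_power s (n1 + n2)) i' j' k'"
      using coeff_tensor_power_append[of ?i n1 ?j ?k s n2 ?i2 ?j2 ?k2] i' j' k'
      by (simp del: tensor_power_sel(4))
    finally show ?thesis .
  qed
  then show ?thesis unfolding restricts_to_def tensor_power_sel(1-3)
    by (intro exI[of _ "M A1 A2"] exI[of _ "M B1 B2"] exI[of _ "M C1 C2"]) simp
qed

text \<open>Fixing the first factor at a position where \<open>s\<close> has a nonzero coefficient,
  and dividing by that coefficient, leaves the smaller power. This makes \<open>min_power\<close>
  monotone in \<open>n\<close>.\<close>

lemma restricts_to_tensor_power_Suc: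
  assumes abc: "a \<in> idx1 s" "b \<in> idx2 s" "c \<in> idx3 s" "coeff s a b c \<noteq> 0"
    and "t \<succeq>\<^sub>T tensor_power s (Suc n)"
  shows "t \<succeq>\<^sub>T tensor_power s n"
proof -
  obtain A B C where *: "\<And>i' j' k'. i' \<in> idx1 (tensor_power s (Suc n)) \<Longrightarrow>
      j' \<in> idx2 (tensor_power s (Suc n)) \<Longrightarrow> k' \<in> idx3 (tensor_power s (Suc n)) \<Longrightarrow>
      (\<Sum>i\<in>idx1 t. \<Sum>j\<in>idx2 t. \<Sum>k\<in>idx3 t. A i' i * B j' j * C k' k * coeff t i j k)
        = coeff (tensor_power s (Suc n)) i' j' k'"
    using assms(5) unfolding restricts_to_def by blast
  have "(\<Sum>i\<in>idx1 t. \<Sum>j\<in>idx2 t. \<Sum>k\<in>idx3 t.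
          A (a # i') i / coeff s a b c * B (b # j') j * C (c # k') k * coeff t i j k)
        = coeff (tensor_power s n) i' j' k'"
    if "i' \<in> idx1 (tensor_power s n)" "j' \<in> idx2 (tensor_power s n)"
      "k' \<in> idx3 (tensor_power s n)" for i' j' k'
  proof -
    have "(\<Sum>i\<in>idx1 t. \<Sum>j\<in>idx2 t. \<Sum>k\<in>idx3 t.
          A (a # i') i / coeff s a b c * B (b # j') j * C (c # k') k * coeff t i j k)
        = (\<Sum>i\<in>idx1 t. \<Sum>j\<in>idx2 t. \<Sum>k\<in>idx3 t.
          A (a # i') i * B (b # j') j * C (c # k') k * coeff t i j k) / coeff s a b c"
      by (simp add: sum_divide_distrib)
    also have "\<dots> = coeff (tensor_power s (Suc n)) (a # i') (b # j') (c # k') / coeff s a b c"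
      using that abc by (subst *) auto
    also have "\<dots> = coeff (tensor_power s n) i' j' k'"
      using abc(4) by (simp add: prod.lessThan_Suc_shift del: prod.lessThan_Suc)
    finally show ?thesis .
  qed
  then show ?thesis unfolding restricts_to_def
    by (intro exI[of _ "\<lambda>i'. \<lambda>i. A (a # i') i / coeff s a b c"]
        exI[of _ "\<lambda>j'. B (b # j')"] exI[of _ "\<lambda>k'. C (c # k')"]) simp
qed

lemma unit_tensor_sel [simp]:
  "idx1 (unit_tensor r) = {1..r}" "idx2 (unit_tensor r) = {1..r}" "idx3 (unit_tensor r) = {1..r}"
  by (simp_all add: unit_tensor_def)

lemma coeff_unit_tensor:
  assumes "i \<in> {1..r}"
  shows "coeff (unit_tensor r :: (nat, 'f::field) tensor3) i j k = (if i = j \<and> j = k then 1 else 0)"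
proof -
  have "coeff (unit_tensor r :: (nat, 'f) tensor3) i j k
      = (\<Sum>l=1..r. if i = l then (if j = i \<and> k = i then 1 else 0) else 0)"
    unfolding unit_tensor_def basis3_def tensor3.sel by (intro sum.cong) auto
  also have "\<dots> = (if j = i \<and> k = i then 1 else 0)" using assms by simp
  finally show ?thesis by auto
qed

text \<open>Factorwise equality of entries is equality of lists, so a power of a unit tensor is
  again diagonal and Tao's bound applies to it.\<close>

lemma coeff_unit_tensor_power:
  assumes "set xs \<subseteq> {1..r}" "length xs = n" "length ys = n" "length zs = n"
  shows "coeff (tensor_power (unit_tensor r :: (nat, 'f::field) tensor3) n) xs ys zs
    = (if xs = ys \<and> ys = zs then 1 else 0)"
proof -
  have "coeff (unit_tensor r :: (nat, 'f) tensor3) (xs ! l) (ys ! l) (zs ! l)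
      = (if xs ! l = ys ! l \<and> ys ! l = zs ! l then 1 else 0)" if "l < n" for l
    using assms that by (intro coeff_unit_tensor) (metis nth_mem subsetD)
  then have "coeff (tensor_power (unit_tensor r :: (nat, 'f) tensor3) n) xs ys zs
      = (\<Prod>l<n. if xs ! l = ys ! l \<and> ys ! l = zs ! l then 1 else 0)"
    unfolding tensor_power_sel by (intro prod.cong refl) simp
  also have "\<dots> = (if \<forall>l<n. xs ! l = ys ! l \<and> ys ! l = zs ! l then 1 else 0)"
    by (auto intro: prod.neutral prod_zero)
  also have "(\<forall>l<n. xs ! l = ys ! l \<and> ys ! l = zs ! l) \<longleftrightarrow> xs = ys \<and> ys = zs"
    using assms by (auto intro: nth_equalityI)
  finally show ?thesis .
qed

section \<open>Relative exponents\<close>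

text \<open>A form of Fekete's lemma. Monotonicity allows rounding \<open>n\<close> up to a multiple
  of \<open>k\<close>, so the remainder costs only one extra \<open>a k\<close>.\<close>

lemma subadditive_mono_convergent:
  fixes a :: "nat \<Rightarrow> real"
  assumes sub: "\<And>m n. a (m + n) \<le> a m + a n" and mono: "mono a" and nonneg: "\<And>n. 0 \<le> a n"
  shows "\<exists>L. (\<lambda>n. a n / real n) \<longlonglongrightarrow> L"
proof -
  \<comment> \<open>The infimum starts at 1 because \<open>a 0 / real 0\<close> is 0 by
    convention.\<close>
  define L where "L = (INF n\<in>{1..}. a n / real n)"
  have bdd: "bdd_below ((\<lambda>n. a n / real n) ` {1..})"
    using nonneg by (intro bdd_belowI2[of _ 0]) auto
  have mult: "a (Suc j * k) \<le> real (Suc j) * a k" for j k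
  proof (induction j)
    case (Suc j)
    then show ?case using sub[of k "Suc j * k"] by (simp add: algebra_simps)
  qed simp
  have bound: "a n / real n \<le> a k / real k + a k / real n" if "k \<ge> 1" "n \<ge> 1" for k n
  proof -
    have "n \<le> Suc (n div k) * k"
      using that dividend_less_div_times[of k n] by simp
    then have "a n \<le> a (Suc (n div k) * k)" by (rule monoD[OF mono])
    also have "\<dots> \<le> real (Suc (n div k)) * a k" by (rule mult)
    also have "\<dots> \<le> (real n / real k + 1) * a k"
      using nonneg[of k] of_nat_div_le_of_nat[of n k, where ?'a = real] by (intro mult_right_mono) auto
    finally have "a n / real n \<le> (real n / real k + 1) * a k / real n"
      by (rule divide_right_mono) simp
    also have "\<dots> = a k / real k + a k / real n" using that by (simp add: field_simps)
    finally show ?thesis .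
  qed
  have "(\<lambda>n. a n / real n) \<longlonglongrightarrow> L"
  proof (rule order_tendstoI)
    fix y assume "y < L"
    have "y < a n / real n" if "n \<ge> 1" for n
      using cINF_lower[OF bdd, of n] that \<open>y < L\<close> by (simp add: L_def)
    then show "\<forall>\<^sub>F n in sequentially. y < a n / real n"
      by (rule eventually_sequentiallyI)
  next
    fix y assume "L < y"
    then obtain k where k: "k \<ge> 1" "a k / real k < y"
      using bdd by (auto simp: L_def cINF_less_iff)
    have "(\<lambda>n. a k / real k + a k / real n) \<longlonglongrightarrow> a k / real k + 0"
      by (intro tendsto_intros lim_const_over_n)
    then have "\<forall>\<^sub>F n in sequentially. a k / real k + a k / real n < y"
      using k(2) by (intro order_tendstoD(2)) auto
    then show "\<forall>\<^sub>F n in sequentially. a n / real n < y"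
      using eventually_ge_at_top[of 1] by eventually_elim (use bound[OF k(1)] in force)
  qed
  then show ?thesis by blast
qed

lemma min_power_le:
  "tensor_power t m \<succeq>\<^sub>T tensor_power s n \<Longrightarrow> min_power t s n \<le> enat m"
  unfolding min_power_def by (intro Inf_lower) auto

text \<open>The infimum of the empty set is infinite, so a finite value comes from a nonempty set
  and is attained by well-ordering.\<close>

lemma min_power_attained:
  assumes "min_power t s n = enat m"
  shows "tensor_power t m \<succeq>\<^sub>T tensor_power s n"
proof -
  let ?S = "enat ` {m. tensor_power t m \<succeq>\<^sub>T tensor_power s n}"
  have "?S \<noteq> {}"
  proof
    assume "?S = {}"
    then have "min_power t s n = Inf {}" unfolding min_power_def by (rule arg_cong)
    also have "\<dots> = \<infinity>" by (simp add: Inf_enat_def)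
    finally have "min_power t s n = \<infinity>" .
    then show False using assms by simp
  qed
  then have "Inf ?S \<in> ?S" by (metis (lifting) ex_in_conv wellorder_InfI)
  then show ?thesis using assms by (auto simp: min_power_def)
qed

text \<open>\<open>lim\<close> is informative only for convergent sequences, so convergence in
  \<open>ereal\<close> comes first, by subadditivity and monotonicity. The bound then passes to the
  limit, where the contribution of \<open>d\<close> disappears.\<close>

lemma rel_exponent_ge:
  fixes t :: "('i, 'f::field) tensor3" and s :: "('j, 'f) tensor3"
  assumes fin: "finite (idx1 t)" "finite (idx2 t)" "finite (idx3 t)"
    and abc: "a \<in> idx1 s" "b \<in> idx2 s" "c \<in> idx3 s" "coeff s a b c \<noteq> 0"
    and lower: "\<And>m n. tensor_power t m \<succeq>\<^sub>T tensor_power s n \<Longrightarrow> l * real n - d \<le> real m"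
  shows "ereal l \<le> rel_exponent t s"
proof -
  define M where "M = min_power t s"
  define X where "X n = ereal (1 / real n) * ereal_of_enat (M n)" for n
  have Suc: "M n \<le> M (Suc n)" for n
  proof (cases "M (Suc n)")
    case (enat m)
    then have "tensor_power t m \<succeq>\<^sub>T tensor_power s n"
      by (intro restricts_to_tensor_power_Suc[OF abc min_power_attained]) (simp add: M_def)
    then show ?thesis using min_power_le[of t m s n] enat by (simp add: M_def)
  qed simp
  have sub: "M (m + n) \<le> M m + M n" for m n
  proof (cases "M m = \<infinity> \<or> M n = \<infinity>")
    case False
    then obtain k l where kl: "M m = enat k" "M n = enat l" by auto
    then have "tensor_power t (k + l) \<succeq>\<^sub>T tensor_power s (m + n)"
      by (intro restricts_to_tensor_power_add[OF fin min_power_attained min_power_attained])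
        (simp_all add: M_def)
    then show ?thesis using min_power_le[of t "k + l" s "m + n"] kl by (simp add: M_def)
  qed auto
  have mono: "mono M" using Suc by (simp add: mono_iff_le_Suc)
  have "convergent X"
  proof (cases "M 1")
    case infinity
    then have inf: "M n = \<infinity>" if "n \<ge> 1" for n using monoD[OF mono that] by simp
    have "X n = \<infinity>" if "n \<ge> 1" for n
      using that by (simp add: X_def inf)
    then have "\<forall>\<^sub>F n in sequentially. X n = \<infinity>"
      by (rule eventually_sequentiallyI)
    then show ?thesis by (intro convergentI[of _ \<infinity>] tendsto_eventually)
  next
    case (enat m1)
    \<comment> \<open>\<open>M 0\<close> is at most \<open>M 1\<close>, and each further step adds
      at most \<open>M 1\<close>.\<close>
    have "M n \<noteq> \<infinity>" for n
    proof (induction n)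
      case 0
      then show ?case using Suc[of 0] enat by (cases "M 0") auto
    next
      case (Suc n)
      then show ?case using sub[of n 1] enat by (cases "M (Suc n)") auto
    qed
    then have "\<exists>m. M n = enat m" for n by simp
    then obtain b where b: "\<And>n. M n = enat (b n)" by metis
    have "real (b (m + n)) \<le> real (b m) + real (b n)" for m n using sub[of m n] by (simp add: b)
    moreover have "mono (\<lambda>n. real (b n))" using mono by (simp add: mono_def b)
    ultimately obtain L where "(\<lambda>n. real (b n) / real n) \<longlonglongrightarrow> L"
      using subadditive_mono_convergent[of "\<lambda>n. real (b n)"] by fastforce
    then have "(\<lambda>n. ereal (real (b n) / real n)) \<longlonglongrightarrow> ereal L" by simp
    moreover have "X = (\<lambda>n. ereal (real (b n) / real n))" by (simp add: X_def b fun_eq_iff)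
    ultimately show ?thesis by (auto intro: convergentI)
  qed
  then have "X \<longlonglongrightarrow> rel_exponent t s"
    unfolding convergent_LIMSEQ_iff rel_exponent_def X_def M_def .
  moreover have "(\<lambda>n. ereal (l - d / real n)) \<longlonglongrightarrow> ereal (l - 0)"
    unfolding lim_ereal by (intro tendsto_intros lim_const_over_n)
  moreover have "ereal (l - d / real n) \<le> X n" if "n \<ge> 1" for n
  proof (cases "M n")
    case infinity
    then show ?thesis using that by (simp add: X_def)
  next
    case (enat m)
    then have "l * real n - d \<le> real m"
      by (intro lower min_power_attained) (simp add: M_def)
    then have "(l * real n - d) / real n \<le> real m / real n" by (rule divide_right_mono) simp
    then show ?thesis using that by (simp add: X_def enat diff_divide_distrib)
  qed
  ultimately show ?thesis
    using LIMSEQ_le[of "\<lambda>n. ereal (l - d / real n)" "ereal (l - 0)" X "rel_exponent t s"]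
    by auto
qed

section \<open>Rank and subrank bounds\<close>

text \<open>The hypothesis says that the slice at \<open>j = b\<close> is a permutation matrix.\<close>

lemma unit_power_restricts_to_bound:
  fixes s :: "('j, 'f::field) tensor3"
  assumes fin: "finite (idx1 s)" and b: "b \<in> idx2 s" and \<sigma>: "\<sigma> ` idx1 s \<subseteq> idx3 s"
    and slice: "\<And>i i'. i \<in> idx1 s \<Longrightarrow> i' \<in> idx1 s \<Longrightarrow>
      coeff s i b (\<sigma> i') = (if i = i' then 1 else 0)"
    and restr: "tensor_power (unit_tensor r :: (nat, 'f) tensor3) m \<succeq>\<^sub>T tensor_power s n"
  shows "card (idx1 s) ^ n \<le> r ^ m"
proof -
  let ?U = "tensor_power (unit_tensor r :: (nat, 'f) tensor3) m"
  let ?I = "{xs. set xs \<subseteq> idx1 s \<and> length xs = n}"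
  let ?P = "{xs. set xs \<subseteq> {1..r} \<and> length xs = m}"
  let ?b = "replicate n b"
  obtain A B C where *: "\<And>i' j' k'. i' \<in> idx1 (tensor_power s n) \<Longrightarrow>
      j' \<in> idx2 (tensor_power s n) \<Longrightarrow> k' \<in> idx3 (tensor_power s n) \<Longrightarrow>
      (\<Sum>i\<in>?P. \<Sum>j\<in>?P. \<Sum>k\<in>?P. A i' i * B j' j * C k' k * coeff ?U i j k)
        = coeff (tensor_power s n) i' j' k'"
    using restr unfolding restricts_to_def tensor_power_sel(1-3) unit_tensor_sel by blast
  \<comment> \<open>With columns relabelled by \<open>\<sigma>\<close>, the slice of the power at
    \<open>replicate n b\<close> is an identity matrix; it factors as \<open>A\<close> times
    \<open>D\<close> through dimension \<open>r ^ m\<close>.\<close>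
  define D where "D i k' = (\<Sum>j\<in>?P. \<Sum>k\<in>?P. B ?b j * C (map \<sigma> k') k * coeff ?U i j k)" for i k'
  have "(\<Sum>i\<in>?P. A x i * D i y) = (if x = y then 1 else 0)" if "x \<in> ?I" "y \<in> ?I" for x y
  proof -
    have "(\<Sum>i\<in>?P. A x i * D i y) = coeff (tensor_power s n) x ?b (map \<sigma> y)"
      using that b \<sigma>
      by (subst *[symmetric]) (auto simp: D_def sum_distrib_left mult_ac)
    also have "\<dots> = (\<Prod>l<n. if x ! l = y ! l then 1 else 0)"
      using that by (auto intro!: prod.cong slice simp: subset_iff)
    also have "\<dots> = (if \<forall>l<n. x ! l = y ! l then 1 else 0)"
      by (auto intro: prod.neutral prod_zero)
    also have "(\<forall>l<n. x ! l = y ! l) \<longleftrightarrow> x = y"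
      using that by (auto intro: nth_equalityI)
    finally show ?thesis .
  qed
  then have "card ?I \<le> card ?P"
    using fin by (intro identity_factorization_card_le[of _ _ A D]) (auto intro: finite_lists_length_eq)
  then show ?thesis using fin by (simp add: card_lists_length_eq)
qed

text \<open>The weights extend multiplicatively to lists, so a condition on the support of a single
  factor suffices. Tao's bound is applied with the heavy lists \<open>X\<close> on every leg; the 3
  counts the legs.\<close>

lemma power_restricts_to_unit_power_bound:
  fixes t :: "('i, 'f::field) tensor3" and p :: "'i \<Rightarrow> real"
  assumes idx: "idx1 t = I" "idx2 t = I" "idx3 t = I" and fin: "finite I"
    and p: "\<And>i. i \<in> I \<Longrightarrow> 0 \<le> p i" "(\<Sum>i\<in>I. p i) \<le> 1" and "0 < c"
    and supp: "\<And>i j k. i \<in> I \<Longrightarrow> j \<in> I \<Longrightarrow> k \<in> I \<Longrightarrow> coeff t i j k \<noteq> 0 \<Longrightarrow> c ^ 3 \<le> p i * p j * p k"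
    and restr: "tensor_power t m \<succeq>\<^sub>T tensor_power (unit_tensor r :: (nat, 'f) tensor3) n"
  shows "real r ^ n * c ^ m \<le> 3"
proof -
  let ?L = "{xs. set xs \<subseteq> I \<and> length xs = m}"
  let ?S = "{xs. set xs \<subseteq> {1..r} \<and> length xs = n}"
  define P where "P xs = (\<Prod>l<m. p (xs ! l))" for xs
  define X where "X = {xs \<in> ?L. c ^ m \<le> P xs}"
  have finL: "finite ?L" "finite ?S" using fin by (auto intro: finite_lists_length_eq)
  have finX: "finite X" by (rule finite_subset[OF _ finL(1)]) (auto simp: X_def)
  have pn: "0 \<le> p (xs ! l)" if "xs \<in> ?L" "l < m" for xs l
    using that p(1) by (auto simp: subset_iff)
  have P0: "0 \<le> P xs" if "xs \<in> ?L" for xs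
    unfolding P_def using that pn by (intro prod_nonneg) auto
  \<comment> \<open>Markov's inequality: all lists together weigh at most 1, so few of them weigh
    \<open>c ^ m\<close> or more.\<close>
  have cardX: "real (card X) * c ^ m \<le> 1"
  proof -
    have "real (card X) * c ^ m = (\<Sum>xs\<in>X. c ^ m)" by simp
    also have "\<dots> \<le> (\<Sum>xs\<in>X. P xs)" by (intro sum_mono) (simp add: X_def)
    also have "\<dots> \<le> (\<Sum>xs\<in>?L. P xs)"
      using finL P0 by (intro sum_mono2) (auto simp: X_def)
    also have "\<dots> = (\<Sum>i\<in>I. p i) ^ m" unfolding P_def by (rule sum_lists_prod[OF fin])
    also have "\<dots> \<le> 1" using p by (intro power_le_one sum_nonneg)
    finally show ?thesis .
  qed
  \<comment> \<open>Three light lists would have a weight product below \<open>c ^ (3 * m)\<close>,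
    against the bound \<open>supp\<close> multiplied over the \<open>m\<close> factors.\<close>
  have cover: "xs \<in> X \<or> ys \<in> X \<or> zs \<in> X"
    if L: "xs \<in> ?L" "ys \<in> ?L" "zs \<in> ?L" and nz: "coeff (tensor_power t m) xs ys zs \<noteq> 0" for xs ys zs
  proof (rule ccontr)
    assume "\<not> ?thesis"
    then have "P xs < c ^ m" "P ys < c ^ m" "P zs < c ^ m" using L by (auto simp: X_def not_le)
    then have "P xs * P ys * P zs < c ^ m * c ^ m * c ^ m"
      using P0 L \<open>0 < c\<close> by (intro mult_strict_mono mult_nonneg_nonneg) auto
    also have "\<dots> = (\<Prod>l<m. c ^ 3)" by (simp add: power3_eq_cube power_mult_distrib)
    also have "\<dots> \<le> (\<Prod>l<m. p (xs ! l) * p (ys ! l) * p (zs ! l))"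
      using L nz \<open>0 < c\<close> by (intro prod_mono) (auto intro!: supp simp: subset_iff)
    also have "\<dots> = P xs * P ys * P zs" by (simp add: P_def prod.distrib)
    finally show False by simp
  qed
  obtain A B C where *: "\<And>i' j' k'. i' \<in> ?S \<Longrightarrow> j' \<in> ?S \<Longrightarrow> k' \<in> ?S \<Longrightarrow>
      (\<Sum>i\<in>?L. \<Sum>j\<in>?L. \<Sum>k\<in>?L. A i' i * B j' j * C k' k * coeff (tensor_power t m) i j k)
        = coeff (tensor_power (unit_tensor r :: (nat, 'f) tensor3) n) i' j' k'"
    using restr unfolding restricts_to_def tensor_power_sel(1-3) unit_tensor_sel idx by blast
  have "card ?S \<le> card X + card X + card X"
  proof (rule diagonal_slice_rank[of ?S X X X ?L ?L ?L "coeff (tensor_power t m)" A B C])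
    fix i' j' k' assume S: "i' \<in> ?S" "j' \<in> ?S" "k' \<in> ?S"
    show "(\<Sum>i\<in>?L. \<Sum>j\<in>?L. \<Sum>k\<in>?L. A i' i * B j' j * C k' k * coeff (tensor_power t m) i j k)
        = (if i' = j' \<and> j' = k' then 1 else 0)"
      unfolding *[OF S] using S by (intro coeff_unit_tensor_power) auto
  qed (use finL finX cover in blast)+
  then have "real (r ^ n) \<le> real (card X + card X + card X)"
    by (simp add: card_lists_length_eq del: of_nat_add of_nat_power)
  then have "real r ^ n * c ^ m \<le> (3 * real (card X)) * c ^ m"
    using \<open>0 < c\<close> by (intro mult_right_mono) auto
  then show ?thesis using cardX by simp
qed

section \<open>The Coppersmith--Winograd tensor\<close>

lemma CW_sel [simp]:
  "idx1 (CW q) = {0..q+1}" "idx2 (CW q) = {0..q+1}" "idx3 (CW q) = {0..q+1}"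
  by (simp_all add: CW_def)

lemma coeff_CW_nonzero:
  assumes "coeff (CW q :: (nat, 'f::field) tensor3) i j k \<noteq> 0"
  shows "(i, j, k) \<in> {(0, 0, q+1), (0, q+1, 0), (q+1, 0, 0)} \<union>
    (\<Union>l\<in>{1..q}. {(0, l, l), (l, 0, l), (l, l, 0)})"
proof (rule ccontr)
  assume no: "\<not> ?thesis"
  have "(\<Sum>l=1..q. basis3 0 l l i j k + basis3 l 0 l i j k + basis3 l l 0 i j k) = (0 :: 'f)"
    using no by (intro sum.neutral) (auto simp: basis3_def)
  then show False using assms no by (auto simp: CW_def basis3_def split: if_splits)
qed

text \<open>This is the permutation behind the slice at \<open>j = 0\<close>: there, index
  \<open>i\<close> meets \<open>CW_dual q i\<close> and nothing else.\<close>

definition CW_dual :: "nat \<Rightarrow> nat \<Rightarrow> nat" where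
  "CW_dual q i = (if i = 0 then q + 1 else if i = q + 1 then 0 else i)"

lemma coeff_CW_slice:
  assumes "i \<in> {0..q+1}" "i' \<in> {0..q+1}"
  shows "coeff (CW q :: (nat, 'f::field) tensor3) i 0 (CW_dual q i') = (if i = i' then 1 else 0)"
proof -
  have "(\<Sum>l=1..q. basis3 0 l l i 0 (CW_dual q i') + basis3 l 0 l i 0 (CW_dual q i')
        + basis3 l l 0 i 0 (CW_dual q i') :: 'f)
      = (\<Sum>l=1..q. if l = i then (if i = i' then 1 else 0) else 0)"
    using assms by (intro sum.cong) (auto simp: basis3_def CW_dual_def)
  also have "\<dots> = (if 1 \<le> i \<and> i \<le> q \<and> i = i' then 1 else 0)" by simp
  finally show ?thesis using assms by (auto simp: CW_def basis3_def CW_dual_def)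
qed

lemma rel_exponent_unit_CW:
  "ereal (log 2 (real q + 2))
    \<le> rel_exponent (unit_tensor 2 :: (nat, 'f::field) tensor3) (CW q :: (nat, 'f) tensor3)"
proof (rule rel_exponent_ge[where a = 0 and b = 0 and c = "q + 1" and d = 0])
  show "coeff (CW q :: (nat, 'f) tensor3) 0 0 (q + 1) \<noteq> 0"
    using coeff_CW_slice[of 0 q 0, where ?'f = 'f] by (simp add: CW_dual_def)
next
  fix m n
  assume "tensor_power (unit_tensor 2 :: (nat, 'f) tensor3) m
    \<succeq>\<^sub>T tensor_power (CW q :: (nat, 'f) tensor3) n"
  then have "card (idx1 (CW q :: (nat, 'f) tensor3)) ^ n \<le> 2 ^ m"
    by (intro unit_power_restricts_to_bound[where b = 0 and \<sigma> = "CW_dual q"] coeff_CW_slice)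
      (auto simp: CW_dual_def)
  then have "real ((q + 2) ^ n) \<le> real (2 ^ m)" by (intro of_nat_mono) simp
  then have "log 2 ((real q + 2) ^ n) \<le> log 2 (2 ^ m)" by (subst log_le_cancel_iff) (auto simp: add_ac)
  then show "log 2 (real q + 2) * real n - 0 \<le> real m"
    by (simp add: log_nat_power mult.commute)
qed auto

text \<open>\<open>cw_f q x\<close> is the Shannon entropy of the weights \<open>p0\<close>,
  \<open>p2\<close> and \<open>q\<close> copies of \<open>p1\<close>. The condition
  \<open>crit\<close> says that it is stationary in \<open>x\<close>, and equates the two weight
  products on the support, \<open>p0 * p0 * p2\<close> and \<open>p0 * p1 * p1\<close>.\<close>

lemma rel_exponent_CW_unit:
  fixes q :: nat and x :: real
  assumes x: "0 < x" "real q * x < 1/3"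
    and crit: "(2/3 - real q * x) * (1/3 - real q * x) = (2 * x)^2"
  shows "0 < cw_f q x"
    and "ereal (1 / cw_f q x)
      \<le> rel_exponent (CW q :: (nat, 'f::field) tensor3) (unit_tensor 2 :: (nat, 'f) tensor3)"
proof -
  define p0 p1 p2 where "p0 = 2/3 - real q * x" and "p1 = 2 * x" and "p2 = 1/3 - real q * x"
  have "0 \<le> real q * x" using x by simp
  then have pos: "0 < p0" "0 < p1" "0 < p2" "p0 < 1" "p2 < 1"
    using x unfolding p0_def p1_def p2_def by linarith+
  have crit': "p0 * p2 = p1 * p1" using crit by (simp add: p0_def p1_def p2_def power2_eq_square)
  have "log 2 p0 + log 2 p2 = 2 * log 2 p1"
    using arg_cong[OF crit', of "log 2"] pos by (simp add: log_mult)
  moreover have "cw_f q x = - p0 * log 2 p0 - real q * x * (2 * log 2 p1) - p2 * log 2 p2"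
    by (simp add: cw_f_def p0_def p1_def p2_def)
  ultimately have "cw_f q x = - p0 * log 2 p0 - real q * x * (log 2 p0 + log 2 p2) - p2 * log 2 p2"
    by simp
  \<comment> \<open>The collected coefficients \<open>p0 + q * x\<close> and
    \<open>p2 + q * x\<close> are \<open>2/3\<close> and \<open>1/3\<close>.\<close>
  then have f: "3 * cw_f q x = - (2 * log 2 p0 + log 2 p2)"
    by (simp add: p0_def p2_def algebra_simps)
  have "log 2 p0 < 0" "log 2 p2 < 0" using pos by simp_all
  with f show fpos: "0 < cw_f q x" by linarith
  define c :: real where "c = 2 powr (- cw_f q x)"
  have c: "0 < c" by (simp add: c_def)
  have "c ^ 3 = 2 powr (2 * log 2 p0 + log 2 p2)"
    using f by (simp add: c_def powr_realpow[symmetric] powr_powr mult.commute add.commute)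
  also have "\<dots> = 2 powr (log 2 p0) * 2 powr (log 2 p0) * 2 powr (log 2 p2)"
    by (simp only: mult_2 powr_add)
  also have "\<dots> = p0 * p0 * p2" using pos by (simp only: powr_log_cancel)
  finally have c3: "c ^ 3 = p0 * p0 * p2" .
  define p where "p i = (if i = 0 then p0 else if i = q + 1 then p2 else p1)" for i :: nat
  have "(\<Sum>i\<in>{0..q+1}. p i) = p 0 + (\<Sum>i\<in>{1..q}. p i) + p (q + 1)"
    by (simp add: sum.atLeast0_atMost_Suc sum.atLeast_Suc_atMost)
  also have "(\<Sum>i\<in>{1..q}. p i) = real q * p1" by (simp add: p_def)
  finally have psum: "(\<Sum>i\<in>{0..q+1}. p i) = 1"
    by (simp add: p_def p0_def p1_def p2_def)
  have "p0 * p1 * p1 = p0 * p0 * p2" by (simp add: crit'[symmetric] mult_ac)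
  then have psupp: "c ^ 3 \<le> p i * p j * p k"
    if "coeff (CW q :: (nat, 'f) tensor3) i j k \<noteq> 0" for i j k
    using coeff_CW_nonzero[OF that] by (auto simp: p_def c3 mult_ac)
  show "ereal (1 / cw_f q x)
      \<le> rel_exponent (CW q :: (nat, 'f) tensor3) (unit_tensor 2 :: (nat, 'f) tensor3)"
  \<comment> \<open>\<open>d\<close> absorbs the factor 3 of the slice rank bound.\<close>
  proof (rule rel_exponent_ge[where a = 1 and b = 1 and c = 1 and d = "log 2 3 / cw_f q x"])
    fix m n
    assume restr: "tensor_power (CW q :: (nat, 'f) tensor3) m
      \<succeq>\<^sub>T tensor_power (unit_tensor 2 :: (nat, 'f) tensor3) n"
    have "real 2 ^ n * c ^ m \<le> 3"
      using pos
      by (intro power_restricts_to_unit_power_bound[OF _ _ _ _ _ eq_refl[OF psum] c psupp restr])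
        (auto simp: p_def)
    then have "log 2 (2 ^ n * c ^ m) \<le> log 2 3"
      using c by (subst log_le_cancel_iff) auto
    then have "real n - cw_f q x * real m \<le> log 2 3"
      using c by (simp add: log_mult log_nat_power c_def mult.commute)
    then show "1 / cw_f q x * real n - log 2 3 / cw_f q x \<le> real m"
      using fpos by (simp add: field_simps)
  qed (auto simp: coeff_unit_tensor)
qed

lemma irr_CW_ge:
  assumes "0 < x" "real q * x < 1/3"
    and "(2/3 - real q * x) * (1/3 - real q * x) = (2 * x)^2"
  shows "ereal (2 * log 2 (real q + 2) / cw_f q x) \<le> 2 * irr (CW q :: (nat, 'f::field) tensor3)"
proof -
  note sub = rel_exponent_CW_unit[OF assms]
  \<comment> \<open>Multiplying lower bounds in \<open>ereal\<close> requires signs, hence this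
    nonnegativity.\<close>
  have "ereal 0 \<le> ereal (log 2 (real q + 2))" by simp
  then have "0 \<le> rel_exponent (unit_tensor 2 :: (nat, 'f) tensor3) (CW q :: (nat, 'f) tensor3)"
    using rel_exponent_unit_CW[of q, where ?'f = 'f] unfolding zero_ereal_def by (rule order_trans)
  then have "ereal (log 2 (real q + 2)) * ereal (1 / cw_f q x) \<le> irr (CW q :: (nat, 'f) tensor3)"
    unfolding irr_def using sub
    by (intro ereal_mult_mono rel_exponent_unit_CW) auto
  then have "ereal 2 * (ereal (log 2 (real q + 2)) * ereal (1 / cw_f q x))
      \<le> ereal 2 * irr (CW q :: (nat, 'f) tensor3)"
    by (intro ereal_mult_left_mono) auto
  then show ?thesis by simp
qed

text \<open>Rationalising the denominator turns all three cases of the theorem into this one \<open>x\<close>.\<close>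

lemma critical_point:
  fixes q :: real
  assumes "q \<ge> 0"
  defines "x \<equiv> 4 / (3 * (3 * q + sqrt (32 + q\<^sup>2)))"
  shows "0 < x" "q * x < 1/3" "(2/3 - q * x) * (1/3 - q * x) = (2 * x)^2"
proof -
  define s where "s = sqrt (32 + q\<^sup>2)"
  have s2: "s * s = 32 + q * q" by (simp add: s_def power2_eq_square)
  have s: "q < s" unfolding s_def by (rule real_less_rsqrt) simp
  define D where "D = 3 * q + s"
  have D: "0 < D" "x = 4 / (3 * D)" using assms s by (auto simp: x_def D_def s_def)
  show "0 < x" using D by simp
  \<comment> \<open>Without denominators this is \<open>4 * q < D\<close>, that is,
    \<open>q < s\<close>.\<close>
  show "q * x < 1/3" using D(1) s by (simp add: D(2) field_simps) (simp add: D_def)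
  have "(2/3 - q * x) * (1/3 - q * x) = (2 * D - 4 * q) * (D - 4 * q) / (9 * D\<^sup>2)"
    using D(1) by (simp add: D(2) field_simps power2_eq_square)
  \<comment> \<open>The factors are \<open>2 * (s + q)\<close> and \<open>s - q\<close>, with
    product \<open>2 * (s * s - q * q)\<close>.\<close>
  also have "(2 * D - 4 * q) * (D - 4 * q) = 64"
    using s2 by (simp add: D_def algebra_simps)
  finally show "(2/3 - q * x) * (1/3 - q * x) = (2 * x)^2"
    using D(1) by (simp add: D(2) field_simps power2_eq_square)
qed

theorem theorem4p7:
  fixes q :: nat
  assumes "q \<ge> 1"
  shows "2 * irr (CW q :: (nat, 'f::field) tensor3) \<ge> ereal
    (if q = 1 then 2 * log 2 3 / cw_f 1 (1/18 * (sqrt 33 - 3))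
     else if q = 2 then 2 * log 2 4 / cw_f 2 (1/9)
     else 2 * log 2 (real q + 2)
            / cw_f q ((3 * real q - sqrt (32 + (real q)^2)) / (6 * ((real q)^2 - 4))))"
proof -
  let ?s = "sqrt (32 + (real q)\<^sup>2)"
  define x where "x = 4 / (3 * (3 * real q + ?s))"
  have main: "ereal (2 * log 2 (real q + 2) / cw_f q x) \<le> 2 * irr (CW q :: (nat, 'f) tensor3)"
    unfolding x_def by (rule irr_CW_ge; rule critical_point) simp_all
  consider "q = 1" | "q = 2" | "q \<ge> 3" using assms by linarith
  then show ?thesis
  proof cases
    case 1
    \<comment> \<open>Multiplying by the conjugate rationalises:
      \<open>(sqrt 33 - 3) * (sqrt 33 + 3) = 24\<close>.\<close>
    have "0 < 3 * (3 + sqrt 33)" by (simp add: add_pos_pos)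
    then have "x = 1/18 * (sqrt 33 - 3)"
      unfolding x_def 1 by (simp add: divide_eq_eq) (simp add: algebra_simps)
    from main[unfolded this] show ?thesis by (simp add: 1)
  next
    case 2
    \<comment> \<open>The closed form for larger \<open>q\<close> would have denominator zero here;
      the rationalised \<open>x\<close> is regular.\<close>
    have "sqrt 36 = 6" by (rule real_sqrt_unique) auto
    then have "x = 1/9" unfolding x_def 2 by simp
    from main[unfolded this] show ?thesis by (simp add: 2)
  next
    case 3
    have "3 * 3 \<le> real q * real q" using 3 by (intro mult_mono) auto
    then have ne: "6 * ((real q)\<^sup>2 - 4) \<noteq> 0" by (simp add: power2_eq_square)
    have "0 < 3 * (3 * real q + ?s)" using 3 by (intro mult_pos_pos add_pos_nonneg) auto
    \<comment> \<open>The conjugate product \<open>(3 * q - ?s) * (3 * q + ?s)\<close> is 8 times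
      \<open>q\<^sup>2 - 4\<close>.\<close>
    moreover have "(3 * real q - ?s) * (3 * (3 * real q + ?s)) = 4 * (6 * ((real q)\<^sup>2 - 4))"
      by (simp add: algebra_simps power2_eq_square)
    ultimately have "x = (3 * real q - ?s) / (6 * ((real q)\<^sup>2 - 4))"
      unfolding x_def using ne by (subst frac_eq_eq) auto
    from main[unfolded this] show ?thesis using 3 by simp
  qed
qed

end
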